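(* Let $k_{n-1},k_n>0$, $\tau=k_n/k_{n-1}$, and $\nu\in\mathbb{R}$ with $\nu\neq 1+\tau$. Consider, for $y'(t)=f(t,y(t))$, the variable timestep method $$\text{Step 1: } \frac{y_{n+1}^{\ast}-y_n}{k_n}=f(t_{n+1},y_{n+1}^{\ast}),\qquad \text{Step 2: } y_{n+1}=y_{n+1}^{\ast}-\frac{\nu}{2}\left\{\frac{2}{1+\tau}y_{n+1}^{\ast}-2y_n+\frac{2\tau}{1+\tau}y_{n-1}\right\}.$$ This method is always consistent. It is second order accurate provided $$\nu=\frac{\tau(1+\tau)}{1+2\tau}.$$ Moreover, for $\nu=\frac{\tau(\tau+1)}{1+2\tau}$ the local truncation error is $$\mathrm{LTE}=\frac{-(1+4\tau)}{6\tau}k_n^3\,y'''(t_n)+\mathcal{O}(k_n^4).$$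
   Context: Here $t_n=t_{n-1}+k_{n-1}$ and $t_{n+1}=t_n+k_n$. Eliminating $y_{n+1}^{\ast}$ between Steps 1 and 2 gives an equivalent 2-step method $$\alpha_2y_{n+1}+\alpha_1y_n+\alpha_0y_{n-1}=k_nf(t_{n+1},\beta_2y_{n+1}+\beta_1y_n+\beta_0y_{n-1})$$ with coefficients $$\alpha_2=\beta_2=\frac{1+\tau}{1+\tau-\nu},\quad \alpha_1=-\frac{1+\tau+\nu\tau}{1+\tau-\nu},\quad \beta_1=-\nu\frac{1+\tau}{1+\tau-\nu},\quad \alpha_0=\beta_0=\frac{\tau\nu}{1+\tau-\nu},$$ which satisfy the normalization $\beta_2+\beta_1+\beta_0=1$. The consistency, order and LTE of the method are those of this 2-step method. The local truncation error is $$\mathrm{LTE}=\sum_{j=0}^{2}\alpha_j\,y(t_{n-1+j})-k_n\sum_{j=0}^{2}\beta_j\,y'(t_{n-1+j}),$$ with Taylor expansion, for smooth $y$ and fixed $\tau$ (so $k_{n-1}=k_n/\tau$) as $k_n\to0$, $$\mathrm{LTE}=[\alpha_2+\alpha_1+\alpha_0]y(t_n)+k_n\left[\alpha_2-\tfrac{1}{\tau}\alpha_0-(\beta_2+\beta_1+\beta_0)\right]y'(t_n)+k_n^2\left[\tfrac12\alpha_2+\tfrac{1}{2\tau^2}\alpha_0-\beta_2+\tfrac1\tau\beta_0\right]y''(t_n)$$ $$+k_n^3\left[\tfrac16\alpha_2-\tfrac{1}{6\tau^3}\alpha_0-\tfrac12\beta_2-\tfrac{1}{2\tau^2}\beta_0\right]y'''(t_n)+\mathcal{O}(k_n^4).$$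 The method is consistent if the first two bracketed coefficients vanish, and a consistent method is second order accurate if the third bracketed coefficient vanishes as well. *)

theory Defs
  imports "HOL-Analysis.Analysis" "HOL-Library.Landau_Symbols"
begin

definition nth_vector_deriv :: "nat \<Rightarrow> (real \<Rightarrow> 'a::real_normed_vector) \<Rightarrow> real \<Rightarrow> 'a" where
  "nth_vector_deriv m y = ((\<lambda>g s. vector_derivative g (at s)) ^^ m) y"

(* Used for open S only, where it says that y is of class C^\<infinity> on S. *)
definition smooth_on :: "real set \<Rightarrow> (real \<Rightarrow> 'a::real_normed_vector) \<Rightarrow> bool" where
  "smooth_on S y \<longleftrightarrow> (\<forall>m. \<forall>s\<in>S. nth_vector_deriv m y differentiable (at s))"


(* One step of the variable timestep method: k0 and k1 are the timesteps k_{n-1} and k_n,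
   tn is t_n, and y0, y1, y2 are y_{n-1}, y_n, y_{n+1}; ystar is y*_{n+1}. *)
definition filtered_backward_euler_step ::
    "real \<Rightarrow> real \<Rightarrow> real \<Rightarrow> (real \<Rightarrow> 'a::real_normed_vector \<Rightarrow> 'a) \<Rightarrow> real \<Rightarrow> 'a \<Rightarrow> 'a \<Rightarrow> 'a \<Rightarrow> bool" where
  "filtered_backward_euler_step k0 k1 \<nu> f tn y0 y1 y2 \<longleftrightarrow>
     (let \<tau> = k1 / k0 in
      \<exists>ystar.
        (ystar - y1) /\<^sub>R k1 = f (tn + k1) ystar \<and>
        y2 = ystar - (\<nu> / 2) *\<^sub>R
          ((2 / (1 + \<tau>)) *\<^sub>R ystar - 2 *\<^sub>R y1 + (2 * \<tau> / (1 + \<tau>)) *\<^sub>R y0))"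

(* The 2-step method with coefficients \<alpha> 0, \<alpha> 1, \<alpha> 2 and \<beta> 0, \<beta> 1, \<beta> 2; f is evaluated once,
   at the averaged state. *)
definition two_step_method ::
    "(nat \<Rightarrow> real) \<Rightarrow> (nat \<Rightarrow> real) \<Rightarrow> real \<Rightarrow> (real \<Rightarrow> 'a::real_normed_vector \<Rightarrow> 'a) \<Rightarrow> real \<Rightarrow> 'a \<Rightarrow> 'a \<Rightarrow> 'a \<Rightarrow> bool" where
  "two_step_method \<alpha> \<beta> k f tn y0 y1 y2 \<longleftrightarrow>
     \<alpha> 2 *\<^sub>R y2 + \<alpha> 1 *\<^sub>R y1 + \<alpha> 0 *\<^sub>R y0 =
       k *\<^sub>R f (tn + k) (\<beta> 2 *\<^sub>R y2 + \<beta> 1 *\<^sub>R y1 + \<beta> 0 *\<^sub>R y0)"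

definition alpha_coeff :: "real \<Rightarrow> real \<Rightarrow> nat \<Rightarrow> real" where
  "alpha_coeff \<tau> \<nu> j =
     [\<tau> * \<nu> / (1 + \<tau> - \<nu>), - (1 + \<tau> + \<nu> * \<tau>) / (1 + \<tau> - \<nu>), (1 + \<tau>) / (1 + \<tau> - \<nu>)] ! j"

definition beta_coeff :: "real \<Rightarrow> real \<Rightarrow> nat \<Rightarrow> real" where
  "beta_coeff \<tau> \<nu> j =
     [\<tau> * \<nu> / (1 + \<tau> - \<nu>), - \<nu> * ((1 + \<tau>) / (1 + \<tau> - \<nu>)), (1 + \<tau>) / (1 + \<tau> - \<nu>)] ! j"


(* The three time levels t_{n-1+j}, j = 0, 1, 2, for k = k_n and k_{n-1} = k / \<tau>. *)
definition time_level :: "real \<Rightarrow> real \<Rightarrow> real \<Rightarrow> nat \<Rightarrow> real" where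
  "time_level \<tau> k tn j = [tn - k / \<tau>, tn, tn + k] ! j"

definition LTE ::
    "(nat \<Rightarrow> real) \<Rightarrow> (nat \<Rightarrow> real) \<Rightarrow> real \<Rightarrow> (real \<Rightarrow> 'a::real_normed_vector) \<Rightarrow> real \<Rightarrow> real \<Rightarrow> 'a" where
  "LTE \<alpha> \<beta> \<tau> y tn k =
     (\<Sum>j\<le>2. \<alpha> j *\<^sub>R y (time_level \<tau> k tn j))
     - k *\<^sub>R (\<Sum>j\<le>2. \<beta> j *\<^sub>R vector_derivative y (at (time_level \<tau> k tn j)))"

(* The conditions below are the vanishing of the coefficients of y(t_n), k_n y'(t_n) and
   k_n^2 y''(t_n) in the Taylor expansion of the LTE about t_n, for fixed \<tau>. *)
definition consistent :: "(nat \<Rightarrow> real) \<Rightarrow> (nat \<Rightarrow> real) \<Rightarrow> real \<Rightarrow> bool" where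
  "consistent \<alpha> \<beta> \<tau> \<longleftrightarrow>
     \<alpha> 2 + \<alpha> 1 + \<alpha> 0 = 0 \<and>
     \<alpha> 2 - (1 / \<tau>) * \<alpha> 0 - (\<beta> 2 + \<beta> 1 + \<beta> 0) = 0"

definition second_order_accurate :: "(nat \<Rightarrow> real) \<Rightarrow> (nat \<Rightarrow> real) \<Rightarrow> real \<Rightarrow> bool" where
  "second_order_accurate \<alpha> \<beta> \<tau> \<longleftrightarrow>
     consistent \<alpha> \<beta> \<tau> \<and>
     (1 / 2) * \<alpha> 2 + (1 / (2 * \<tau>\<^sup>2)) * \<alpha> 0 - \<beta> 2 + (1 / \<tau>) * \<beta> 0 = 0"

end

theory Submission
  imports Defs
begin

text \<open>
  Step 2 is linear, and since \<open>\<nu> \<noteq> 1 + \<tau>\<close> it can be solved for the intermediate value: this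
  value is the \<open>\<beta>\<close>-average of the three states, so Step 1 becomes the two-step method
  (\<open>filtered_step_iff_two_step\<close>). Consistency and the order condition are then
  rational identities in \<open>\<tau>\<close> and \<open>\<nu>\<close>.

  The error estimate rests on Taylor's theorem with an \<open>O(h ^ Suc n)\<close> remainder
  (\<open>taylor_remainder_bound\<close>). The values lie in a normed space that need not be complete, so the
  proof avoids integrals: the remainder of a function has as its derivative the remainder, of one
  order less, of the derivative, and the mean value inequality then raises the order by one.
  Expanding \<open>y\<close> to third and \<open>y'\<close> to second order
  at the outer time levels gives the expansion of the local truncation error for arbitrary
  coefficients (\<open>LTE_expansion\<close>). For the given \<open>\<nu>\<close> its first three coefficients vanish and
  that of \<open>k ^ 3\<close> is \<open>-(1 + 4 * \<tau>) / (6 * \<tau>)\<close>.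
\<close>

section \<open>Taylor's theorem in normed spaces\<close>

text \<open>
  \<open>D m\<close> plays the part of the \<open>m\<close>-th derivative of \<open>D 0\<close>. Passing the whole sequence makes
  differentiation an index shift, which is what the induction on the order needs.
\<close>

definition taylor_remainder ::
    "nat \<Rightarrow> (nat \<Rightarrow> real \<Rightarrow> 'a::real_normed_vector) \<Rightarrow> real \<Rightarrow> real \<Rightarrow> 'a" where
  "taylor_remainder n D t h = D 0 (t + h) - (\<Sum>i\<le>n. (h ^ i / fact i) *\<^sub>R D i t)"

lemma taylor_remainder_0 [simp]: "taylor_remainder n D t 0 = 0"
proof -
  have "(\<Sum>i\<le>n. (0 ^ i / fact i) *\<^sub>R D i t) = (\<Sum>i\<le>n. if i = 0 then D 0 t else 0)"
    by (rule sum.cong) auto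
  then show ?thesis
    by (simp add: taylor_remainder_def)
qed

lemma taylor_remainder_has_vector_derivative:
  assumes "(D 0 has_vector_derivative D 1 (t + h)) (at (t + h))"
  shows "(taylor_remainder (Suc n) D t has_vector_derivative
           taylor_remainder n (\<lambda>m. D (Suc m)) t h) (at h within A)"
proof -
  have shift: "((\<lambda>x. D 0 (t + x)) has_vector_derivative D 1 (t + h)) (at h within A)"
  proof -
    have "((+) t has_vector_derivative 1) (at h within A)"
      using has_vector_derivative_add[OF has_vector_derivative_const has_vector_derivative_id]
      by simp
    from vector_diff_chain_within[OF this has_vector_derivative_at_within[OF assms]]
    show ?thesis
      by (simp add: o_def)
  qed
  have monomial: "((\<lambda>x::real. x ^ Suc i / fact (Suc i)) has_real_derivative h ^ i / fact i)
      (at h within A)" for i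
    by (rule derivative_eq_intros refl | simp)+
  have "((\<lambda>x. D 0 (t + x) - (D 0 t + (\<Sum>i\<le>n. (x ^ Suc i / fact (Suc i)) *\<^sub>R D (Suc i) t)))
      has_vector_derivative D 1 (t + h) - (0 + (\<Sum>i\<le>n. (h ^ i / fact i) *\<^sub>R D (Suc i) t)))
      (at h within A)"
    using has_vector_derivative_scaleR[OF monomial has_vector_derivative_const]
    by (intro has_vector_derivative_diff shift has_vector_derivative_add
        has_vector_derivative_const has_vector_derivative_sum) simp
  then show ?thesis
    by (simp add: taylor_remainder_def[abs_def] sum.atMost_Suc_shift del: sum.atMost_Suc fact_Suc)
qed

text \<open>
  In the base case, differentiability of \<open>D 0\<close> at the single point \<open>t\<close> makes the difference
  quotients bounded. In the step, the induction hypothesis for the shifted sequence bounds the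
  derivative of the remainder on the segment from \<open>0\<close> to \<open>h\<close>; as the remainder vanishes at
  \<open>0\<close>, the mean value inequality supplies the extra factor \<open>\<bar>h\<bar>\<close>.
\<close>

lemma taylor_remainder_bound:
  fixes D :: "nat \<Rightarrow> real \<Rightarrow> 'a::real_normed_vector"
  assumes "open S" and "t \<in> S"
    and "\<And>m s. s \<in> S \<Longrightarrow> (D m has_vector_derivative D (Suc m) s) (at s)"
  shows "\<exists>C. \<forall>\<^sub>F h in nhds 0. norm (taylor_remainder n D t h) \<le> C * \<bar>h\<bar> ^ Suc n"
  using assms(3)
proof (induction n arbitrary: D)
  case 0
  have "(D 0 has_derivative (\<lambda>h. h *\<^sub>R D 1 t)) (at t)"
    using 0 \<open>t \<in> S\<close> by (simp add: has_vector_derivative_def)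
  then obtain d where "d > 0"
    and d: "\<And>x. norm (x - t) < d \<Longrightarrow> norm (D 0 x - D 0 t - (x - t) *\<^sub>R D 1 t) \<le> 1 * norm (x - t)"
    unfolding has_derivative_at_alt using zero_less_one by blast
  have "norm (taylor_remainder 0 D t h) \<le> (1 + norm (D 1 t)) * \<bar>h\<bar> ^ Suc 0" if "\<bar>h\<bar> < d" for h
  proof -
    have "norm (D 0 (t + h) - D 0 t) \<le> norm (D 0 (t + h) - D 0 t - h *\<^sub>R D 1 t) + norm (h *\<^sub>R D 1 t)"
      by (metis add.commute norm_triangle_sub)
    also have "\<dots> \<le> (1 + norm (D 1 t)) * \<bar>h\<bar>"
      using d[of "t + h"] that by (simp add: algebra_simps)
    finally show ?thesis
      by (simp add: taylor_remainder_def)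
  qed
  then show ?case
    using \<open>d > 0\<close> by (auto simp: eventually_nhds_metric dist_real_def)
next
  case (Suc n)
  obtain C where "\<forall>\<^sub>F h in nhds 0. norm (taylor_remainder n (\<lambda>m. D (Suc m)) t h) \<le> C * \<bar>h\<bar> ^ Suc n"
    using Suc.IH[of "\<lambda>m. D (Suc m)"] Suc.prems by blast
  then obtain d where "d > 0"
    and d: "\<And>h. \<bar>h\<bar> < d \<Longrightarrow> norm (taylor_remainder n (\<lambda>m. D (Suc m)) t h) \<le> C * \<bar>h\<bar> ^ Suc n"
    by (auto simp: eventually_nhds_metric dist_real_def)
  obtain e where "e > 0" and e: "ball t e \<subseteq> S"
    using assms(1,2) open_contains_ball by blast
  have "norm (taylor_remainder (Suc n) D t h) \<le> \<bar>C\<bar> * \<bar>h\<bar> ^ Suc (Suc n)"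
    if h: "\<bar>h\<bar> < min d e" for h
  proof -
    let ?I = "closed_segment 0 h"
    have inside: "\<bar>x\<bar> \<le> \<bar>h\<bar>" if "x \<in> ?I" for x
      using segment_bound1[OF that] by simp
    have deriv: "(taylor_remainder (Suc n) D t has_derivative
        (\<lambda>u. u *\<^sub>R taylor_remainder n (\<lambda>m. D (Suc m)) t x)) (at x within ?I)" if "x \<in> ?I" for x
    proof -
      have "t + x \<in> S"
        using e inside[OF that] h by (auto simp: dist_real_def)
      then have "(D 0 has_vector_derivative D 1 (t + x)) (at (t + x))"
        using Suc.prems[of "t + x" 0] by simp
      then show ?thesis
        using taylor_remainder_has_vector_derivative unfolding has_vector_derivative_def by blast
    qed
    have bound: "onorm (\<lambda>u. u *\<^sub>R taylor_remainder n (\<lambda>m. D (Suc m)) t x) \<le> \<bar>C\<bar> * \<bar>h\<bar> ^ Suc n"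
      if "x \<in> ?I" for x
    proof (rule onorm_le)
      fix u :: real
      have "norm (taylor_remainder n (\<lambda>m. D (Suc m)) t x) \<le> C * \<bar>x\<bar> ^ Suc n"
        using d inside[OF that] h by simp
      also have "\<dots> \<le> \<bar>C\<bar> * \<bar>h\<bar> ^ Suc n"
        using inside[OF that] by (intro mult_mono power_mono) auto
      finally show "norm (u *\<^sub>R taylor_remainder n (\<lambda>m. D (Suc m)) t x) \<le> \<bar>C\<bar> * \<bar>h\<bar> ^ Suc n * norm u"
        by (metis abs_ge_zero mult.commute mult_left_mono norm_scaleR real_norm_def)
    qed
    have "norm (taylor_remainder (Suc n) D t h - taylor_remainder (Suc n) D t 0)
        \<le> \<bar>C\<bar> * \<bar>h\<bar> ^ Suc n * norm (h - 0)"
      by (rule differentiable_bound[OF _ deriv bound]) auto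
    then show ?thesis
      by (simp add: mult_ac)
  qed
  moreover have "min d e > 0"
    using \<open>d > 0\<close> \<open>e > 0\<close> by simp
  ultimately show ?case
    by (auto simp only: eventually_nhds_metric dist_real_def diff_0_right)
qed

corollary taylor_remainder_bigo:
  fixes D :: "nat \<Rightarrow> real \<Rightarrow> 'a::real_normed_vector"
  assumes "open S" and "t \<in> S"
    and "\<And>m s. s \<in> S \<Longrightarrow> (D m has_vector_derivative D (Suc m) s) (at s)"
  shows "(\<lambda>k. norm (taylor_remainder n D t (c * k))) \<in> O[at_right 0](\<lambda>k. k ^ Suc n)"
proof -
  obtain C where C: "\<forall>\<^sub>F h in nhds 0. norm (taylor_remainder n D t h) \<le> C * \<bar>h\<bar> ^ Suc n"
    using taylor_remainder_bound[of S t D n] assms by blast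
  have "((\<lambda>k. c * k) \<longlongrightarrow> c * 0) (at_right 0)"
    by (intro tendsto_intros)
  then have "\<forall>\<^sub>F k in at_right 0. norm (taylor_remainder n D t (c * k)) \<le> C * \<bar>c * k\<bar> ^ Suc n"
    using C by (auto simp: filterlim_iff)
  then show ?thesis
    by (intro bigoI[where c = "C * \<bar>c\<bar> ^ Suc n"])
      (simp add: abs_mult power_mult_distrib power_abs mult_ac)
qed

lemma smooth_on_has_vector_derivative:
  assumes "smooth_on S y" and "s \<in> S"
  shows "(nth_vector_deriv m y has_vector_derivative nth_vector_deriv (Suc m) y s) (at s)"
  using assms by (simp add: smooth_on_def nth_vector_deriv_def flip: vector_derivative_works)

section \<open>The expansion of the local truncation error\<close>

lemma sum_upto_2: "(\<Sum>j\<le>2::nat. g j) = g 0 + g 1 + (g 2 :: 'b::comm_monoid_add)"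
  by (simp add: numeral_2_eq_2)

lemma sum_upto_3: "(\<Sum>j\<le>3::nat. g j) = g 0 + g 1 + g 2 + (g 3 :: 'b::comm_monoid_add)"
  by (simp add: numeral_3_eq_3 numeral_2_eq_2)

text \<open>
  The middle time level is \<open>tn\<close> itself, so only the outer two contribute remainders. The factor
  \<open>k\<close> in front of the derivatives is why second order suffices for \<open>y'\<close>.
\<close>

lemma LTE_expansion:
  fixes y :: "real \<Rightarrow> 'a::real_normed_vector"
  assumes "open S" and "tn \<in> S" and "smooth_on S y" and "\<tau> \<noteq> 0"
  shows "(\<lambda>k. norm (LTE \<alpha> \<beta> \<tau> y tn k -
      ((\<alpha> 2 + \<alpha> 1 + \<alpha> 0) *\<^sub>R y tn
       + (k * (\<alpha> 2 - (1 / \<tau>) * \<alpha> 0 - (\<beta> 2 + \<beta> 1 + \<beta> 0))) *\<^sub>R nth_vector_deriv 1 y tn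
       + (k ^ 2 * ((1 / 2) * \<alpha> 2 + (1 / (2 * \<tau>\<^sup>2)) * \<alpha> 0 - \<beta> 2 + (1 / \<tau>) * \<beta> 0))
           *\<^sub>R nth_vector_deriv 2 y tn
       + (k ^ 3 * ((1 / 6) * \<alpha> 2 - (1 / (6 * \<tau> ^ 3)) * \<alpha> 0 - (1 / 2) * \<beta> 2 - (1 / (2 * \<tau>\<^sup>2)) * \<beta> 0))
           *\<^sub>R nth_vector_deriv 3 y tn)))
    \<in> O[at_right 0](\<lambda>k. k ^ 4)"
    (is "(\<lambda>k. norm (?LTE k - ?E k)) \<in> _")
proof -
  define D where "D m = nth_vector_deriv m y" for m
  define R where "R c k = taylor_remainder 3 D tn (c * k)" for c k
  define R' where "R' c k = taylor_remainder 2 (\<lambda>m. D (Suc m)) tn (c * k)" for c k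
  define c where "c = - 1 / \<tau>"
  have D: "(D m has_vector_derivative D (Suc m) s) (at s)" if "s \<in> S" for m s
    using smooth_on_has_vector_derivative[OF assms(3) that] by (simp add: D_def)
  have R: "(\<lambda>k. norm (R b k)) \<in> O[at_right 0](\<lambda>k. k ^ 4)" for b
    using taylor_remainder_bigo[of S tn D 3 b] assms(1,2) D by (simp add: R_def)
  have "(\<lambda>k. norm (R' b k)) \<in> O[at_right 0](\<lambda>k. k ^ 3)" for b
    using taylor_remainder_bigo[of S tn "\<lambda>m. D (Suc m)" 2 b] assms(1,2) D by (simp add: R'_def)
  then have R': "(\<lambda>k. k * norm (R' b k)) \<in> O[at_right 0](\<lambda>k. k ^ 4)" for b
    using landau_o.big.mult[OF landau_o.big_refl[of "\<lambda>k::real. k" "at_right 0"],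
        of "\<lambda>k. norm (R' b k)" "\<lambda>k. k ^ 3"]
    by (simp add: power_Suc[symmetric] del: power_Suc)
  have y: "y (tn + b * k) = y tn + (b * k) *\<^sub>R D 1 tn + ((b * k)\<^sup>2 / 2) *\<^sub>R D 2 tn
      + ((b * k) ^ 3 / 6) *\<^sub>R D 3 tn + R b k" for b k
    by (simp add: R_def taylor_remainder_def sum_upto_3 D_def nth_vector_deriv_def fact_numeral)
  have y': "vector_derivative y (at (tn + b * k)) = D 1 tn + (b * k) *\<^sub>R D 2 tn
      + ((b * k)\<^sup>2 / 2) *\<^sub>R D 3 tn + R' b k" for b k
    by (simp add: R'_def taylor_remainder_def sum_upto_2 D_def nth_vector_deriv_def
        fact_numeral numeral_3_eq_3 numeral_2_eq_2)
  \<comment> \<open>In terms of \<open>c\<close> both sides are polynomial, so that expanding products proves them equal.\<close>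
  have inverse_powers: "1 / \<tau> = - c" "1 / (2 * \<tau>\<^sup>2) = c\<^sup>2 / 2" "1 / (6 * \<tau> ^ 3) = - (c ^ 3 / 6)"
    using assms(4) by (simp_all add: c_def field_simps power2_eq_square power3_eq_cube)
  have levels: "time_level \<tau> k tn 0 = tn + c * k" "time_level \<tau> k tn 1 = tn + 0 * k"
      "time_level \<tau> k tn 2 = tn + 1 * k" for k
    by (simp_all add: time_level_def c_def)
  have R_0: "R 0 k = 0" "R' 0 k = 0" for k
    by (simp_all add: R_def R'_def)
  have remainder: "?LTE k - ?E k = \<alpha> 0 *\<^sub>R R c k + \<alpha> 2 *\<^sub>R R 1 k
      - (k * \<beta> 0) *\<^sub>R R' c k - (k * \<beta> 2) *\<^sub>R R' 1 k" for k
    unfolding LTE_def sum_upto_2 levels y y' inverse_powers D_def[symmetric]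
    by (simp add: R_0 algebra_simps power2_eq_square power3_eq_cube flip: scaleR_2)
  let ?B = "\<lambda>k. \<bar>\<alpha> 0\<bar> * norm (R c k) + \<bar>\<alpha> 2\<bar> * norm (R 1 k)
      + \<bar>\<beta> 0\<bar> * (k * norm (R' c k)) + \<bar>\<beta> 2\<bar> * (k * norm (R' 1 k))"
  have "norm (?LTE k - ?E k) \<le> ?B k" if "k > 0" for k
  proof -
    have "norm (?LTE k - ?E k) \<le> norm (\<alpha> 0 *\<^sub>R R c k) + norm (\<alpha> 2 *\<^sub>R R 1 k)
        + norm ((k * \<beta> 0) *\<^sub>R R' c k) + norm ((k * \<beta> 2) *\<^sub>R R' 1 k)"
      unfolding remainder
      by (intro norm_triangle_le_diff norm_triangle_le add_mono order_refl)
    also have "\<dots> = ?B k"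
      using that by (simp add: abs_mult mult_ac)
    finally show ?thesis .
  qed
  then have "\<forall>\<^sub>F k in at_right 0. norm (norm (?LTE k - ?E k)) \<le> 1 * norm (?B k)"
    by (intro eventually_at_right_less[THEN eventually_mono]) (smt (verit) norm_ge_zero real_norm_def)
  then have "(\<lambda>k. norm (?LTE k - ?E k)) \<in> O[at_right 0](?B)"
    by (rule bigoI)
  also have "?B \<in> O[at_right 0](\<lambda>k. k ^ 4)"
  proof -
    have cmult: "(\<lambda>k. b * g k) \<in> O[at_right 0](\<lambda>k. k ^ 4)"
      if "g \<in> O[at_right 0](\<lambda>k. k ^ 4)" for b :: real and g
      using that by (cases "b = 0") simp_all
    show ?thesis
      by (intro sum_in_bigo cmult R R')
  qed
  finally show ?thesis .
qed

section \<open>The filtered backward Euler method\<close>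

text \<open>
  Solving Step 2 for the intermediate value determines it uniquely, which turns the existential
  quantifier into a substitution.
\<close>

lemma filtered_step_iff_two_step:
  assumes "k0 > 0" and "k1 > 0" and "\<tau> = k1 / k0" and "\<nu> \<noteq> 1 + \<tau>"
  shows "filtered_backward_euler_step k0 k1 \<nu> f tn y0 y1 y2 \<longleftrightarrow>
    two_step_method (alpha_coeff \<tau> \<nu>) (beta_coeff \<tau> \<nu>) k1 f tn y0 y1 y2"
proof -
  let ?\<alpha> = "alpha_coeff \<tau> \<nu>" and ?\<beta> = "beta_coeff \<tau> \<nu>"
  define z where "z = ?\<beta> 2 *\<^sub>R y2 + ?\<beta> 1 *\<^sub>R y1 + ?\<beta> 0 *\<^sub>R y0"
  have \<tau>: "\<tau> > 0" "1 + \<tau> \<noteq> 0" "1 + \<tau> - \<nu> \<noteq> 0"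
    using assms by (auto simp: add_pos_pos less_imp_neq[symmetric])
  \<comment> \<open>The factor of the intermediate value in Step 2; nonzero exactly because \<open>\<nu> \<noteq> 1 + \<tau>\<close>.\<close>
  define q where "q = (1 + \<tau> - \<nu>) / (1 + \<tau>)"
  have q: "q \<noteq> 0" "q * ?\<beta> 2 = 1" "q * ?\<beta> 1 = - \<nu>" "q * ?\<beta> 0 = \<nu> * \<tau> / (1 + \<tau>)"
    using \<tau> by (simp_all add: q_def beta_coeff_def)
  have "q *\<^sub>R z = y2 - \<nu> *\<^sub>R y1 + (\<nu> * \<tau> / (1 + \<tau>)) *\<^sub>R y0"
    by (simp add: z_def scaleR_add_right q del: One_nat_def)
  moreover have "w - (\<nu> / 2) *\<^sub>R ((2 / (1 + \<tau>)) *\<^sub>R w - 2 *\<^sub>R y1 + (2 * \<tau> / (1 + \<tau>)) *\<^sub>R y0)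
      = q *\<^sub>R w + \<nu> *\<^sub>R y1 - (\<nu> * \<tau> / (1 + \<tau>)) *\<^sub>R y0" for w
  proof -
    have q_eq: "q = 1 - \<nu> / (1 + \<tau>)"
      using \<tau> by (simp add: q_def field_simps)
    show ?thesis
      unfolding q_eq by (simp add: algebra_simps)
  qed
  ultimately have step2:
    "y2 = w - (\<nu> / 2) *\<^sub>R ((2 / (1 + \<tau>)) *\<^sub>R w - 2 *\<^sub>R y1 + (2 * \<tau> / (1 + \<tau>)) *\<^sub>R y0) \<longleftrightarrow> w = z" for w
    using q(1) by (metis (no_types, lifting) add_diff_cancel_right' diff_add_cancel
        diff_add_eq scaleR_cancel_left)
  \<comment> \<open>Up to the factor \<open>1 / k1\<close>, the left-hand side of Step 1 is the \<open>\<beta>\<close>-average minus \<open>y1\<close>, hence these \<open>\<alpha>\<close>.\<close>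
  have coeffs: "?\<alpha> 2 = ?\<beta> 2" "?\<alpha> 1 = ?\<beta> 1 - 1" "?\<alpha> 0 = ?\<beta> 0"
    using \<tau> by (simp_all add: alpha_coeff_def beta_coeff_def field_simps)
  have "filtered_backward_euler_step k0 k1 \<nu> f tn y0 y1 y2 \<longleftrightarrow> (z - y1) /\<^sub>R k1 = f (tn + k1) z"
    by (simp add: filtered_backward_euler_step_def Let_def step2 flip: assms(3))
  also have "\<dots> \<longleftrightarrow> z - y1 = k1 *\<^sub>R f (tn + k1) z"
    using assms(2) divideR_right[of k1 "f (tn + k1) z" "z - y1"] by (metis less_irrefl)
  also have "z - y1 = ?\<alpha> 2 *\<^sub>R y2 + ?\<alpha> 1 *\<^sub>R y1 + ?\<alpha> 0 *\<^sub>R y0"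
    by (simp add: z_def coeffs algebra_simps del: One_nat_def)
  finally show ?thesis
    by (simp add: two_step_method_def z_def)
qed

lemma consistent_coeffs:
  assumes "\<tau> > 0" and "\<nu> \<noteq> 1 + \<tau>"
  shows "consistent (alpha_coeff \<tau> \<nu>) (beta_coeff \<tau> \<nu>) \<tau>"
proof -
  define q where "q = 1 + \<tau> - \<nu>"
  have "q \<noteq> 0" "\<nu> = 1 + \<tau> - q"
    using assms(2) by (simp_all add: q_def)
  then show ?thesis
    using assms(1)
    by (simp add: consistent_def alpha_coeff_def beta_coeff_def) (simp add: field_simps)
qed

text \<open>
  For this \<open>\<nu>\<close> the common denominator \<open>1 + \<tau> - \<nu>\<close> equals \<open>(1 + \<tau>)\<^sup>2 / (1 + 2 * \<tau>)\<close>, and a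
  factor \<open>1 + \<tau>\<close> cancels.
\<close>

lemma coeffs_at_second_order:
  assumes "\<tau> > 0" and "\<nu> = \<tau> * (1 + \<tau>) / (1 + 2 * \<tau>)"
  shows "alpha_coeff \<tau> \<nu> 2 = (1 + 2 * \<tau>) / (1 + \<tau>)" "alpha_coeff \<tau> \<nu> 0 = \<tau>\<^sup>2 / (1 + \<tau>)"
    and "beta_coeff \<tau> \<nu> 2 = (1 + 2 * \<tau>) / (1 + \<tau>)" "beta_coeff \<tau> \<nu> 0 = \<tau>\<^sup>2 / (1 + \<tau>)"
proof -
  have pos: "1 + \<tau> > 0" "1 + 2 * \<tau> > 0"
    using assms(1) by auto
  then have "1 + \<tau> - \<nu> = (1 + \<tau>)\<^sup>2 / (1 + 2 * \<tau>)"
    unfolding assms(2) by (simp add: field_simps power2_eq_square)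
  moreover have "\<tau> * \<nu> / ((1 + \<tau>)\<^sup>2 / (1 + 2 * \<tau>)) = \<tau>\<^sup>2 / (1 + \<tau>)"
    unfolding assms(2) using pos by (simp add: power2_eq_square)
  moreover have "(1 + \<tau>) / ((1 + \<tau>)\<^sup>2 / (1 + 2 * \<tau>)) = (1 + 2 * \<tau>) / (1 + \<tau>)"
    using pos by (simp add: power2_eq_square)
  ultimately show "alpha_coeff \<tau> \<nu> 2 = (1 + 2 * \<tau>) / (1 + \<tau>)"
    "alpha_coeff \<tau> \<nu> 0 = \<tau>\<^sup>2 / (1 + \<tau>)"
    "beta_coeff \<tau> \<nu> 2 = (1 + 2 * \<tau>) / (1 + \<tau>)" "beta_coeff \<tau> \<nu> 0 = \<tau>\<^sup>2 / (1 + \<tau>)"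
    by (simp_all add: alpha_coeff_def beta_coeff_def)
qed

lemma second_order_accurate_coeffs:
  assumes "\<tau> > 0" and "\<nu> \<noteq> 1 + \<tau>" and "\<nu> = \<tau> * (1 + \<tau>) / (1 + 2 * \<tau>)"
  shows "second_order_accurate (alpha_coeff \<tau> \<nu>) (beta_coeff \<tau> \<nu>) \<tau>"
  using consistent_coeffs[OF assms(1,2)] assms(1)
  unfolding second_order_accurate_def coeffs_at_second_order[OF assms(1,3)]
  by (simp add: divide_simps power2_eq_square)

lemma LTE_third_coefficient:
  assumes "\<tau> > 0" and "\<nu> = \<tau> * (1 + \<tau>) / (1 + 2 * \<tau>)"
  shows "(1 / 6) * alpha_coeff \<tau> \<nu> 2 - (1 / (6 * \<tau> ^ 3)) * alpha_coeff \<tau> \<nu> 0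
      - (1 / 2) * beta_coeff \<tau> \<nu> 2 - (1 / (2 * \<tau>\<^sup>2)) * beta_coeff \<tau> \<nu> 0
    = - (1 + 4 * \<tau>) / (6 * \<tau>)"
  using assms(1) unfolding coeffs_at_second_order[OF assms]
  by (simp add: divide_simps power2_eq_square power3_eq_cube) (simp add: algebra_simps)

theorem proposition3p3:
  fixes k0 k1 \<tau> \<nu> :: real
  assumes "k0 > 0" and "k1 > 0" and "\<tau> = k1 / k0" and "\<nu> \<noteq> 1 + \<tau>"
  shows
    "(\<forall>(f :: real \<Rightarrow> 'a::real_normed_vector \<Rightarrow> 'a) tn y0 y1 y2.
        filtered_backward_euler_step k0 k1 \<nu> f tn y0 y1 y2 \<longleftrightarrow>
        two_step_method (alpha_coeff \<tau> \<nu>) (beta_coeff \<tau> \<nu>) k1 f tn y0 y1 y2) \<and>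
     consistent (alpha_coeff \<tau> \<nu>) (beta_coeff \<tau> \<nu>) \<tau> \<and>
     (\<nu> = \<tau> * (1 + \<tau>) / (1 + 2 * \<tau>) \<longrightarrow>
        second_order_accurate (alpha_coeff \<tau> \<nu>) (beta_coeff \<tau> \<nu>) \<tau>) \<and>
     (\<nu> = \<tau> * (\<tau> + 1) / (1 + 2 * \<tau>) \<longrightarrow>
        (\<forall>(y :: real \<Rightarrow> 'a) S tn. open S \<longrightarrow> tn \<in> S \<longrightarrow> smooth_on S y \<longrightarrow>
           (\<lambda>k. norm (LTE (alpha_coeff \<tau> \<nu>) (beta_coeff \<tau> \<nu>) \<tau> y tn k
                      - (- (1 + 4 * \<tau>) / (6 * \<tau>) * k ^ 3) *\<^sub>R nth_vector_deriv 3 y tn))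
             \<in> O[at_right 0](\<lambda>k. k ^ 4)))"
proof (intro conjI impI allI)
  have "\<tau> > 0"
    using assms by simp
  show "filtered_backward_euler_step k0 k1 \<nu> f tn y0 y1 y2 \<longleftrightarrow>
      two_step_method (alpha_coeff \<tau> \<nu>) (beta_coeff \<tau> \<nu>) k1 f tn y0 y1 y2"
    for f :: "real \<Rightarrow> 'a \<Rightarrow> 'a" and tn y0 y1 y2
    by (rule filtered_step_iff_two_step[OF assms])
  show "consistent (alpha_coeff \<tau> \<nu>) (beta_coeff \<tau> \<nu>) \<tau>"
    by (rule consistent_coeffs[OF \<open>\<tau> > 0\<close> assms(4)])
  show second_order: "second_order_accurate (alpha_coeff \<tau> \<nu>) (beta_coeff \<tau> \<nu>) \<tau>"
    if "\<nu> = \<tau> * (1 + \<tau>) / (1 + 2 * \<tau>)"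
    by (rule second_order_accurate_coeffs[OF \<open>\<tau> > 0\<close> assms(4) that])
  show "(\<lambda>k. norm (LTE (alpha_coeff \<tau> \<nu>) (beta_coeff \<tau> \<nu>) \<tau> y tn k
          - (- (1 + 4 * \<tau>) / (6 * \<tau>) * k ^ 3) *\<^sub>R nth_vector_deriv 3 y tn))
      \<in> O[at_right 0](\<lambda>k. k ^ 4)"
    if \<nu>: "\<nu> = \<tau> * (\<tau> + 1) / (1 + 2 * \<tau>)" and y: "open S" "tn \<in> S" "smooth_on S y"
    for y :: "real \<Rightarrow> 'a" and S tn
  proof -
    have \<nu>': "\<nu> = \<tau> * (1 + \<tau>) / (1 + 2 * \<tau>)"
      using \<nu> by (simp add: add.commute)
    have vanish: "alpha_coeff \<tau> \<nu> 2 + alpha_coeff \<tau> \<nu> 1 + alpha_coeff \<tau> \<nu> 0 = 0"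
      "alpha_coeff \<tau> \<nu> 2 - (1 / \<tau>) * alpha_coeff \<tau> \<nu> 0
        - (beta_coeff \<tau> \<nu> 2 + beta_coeff \<tau> \<nu> 1 + beta_coeff \<tau> \<nu> 0) = 0"
      "(1 / 2) * alpha_coeff \<tau> \<nu> 2 + (1 / (2 * \<tau>\<^sup>2)) * alpha_coeff \<tau> \<nu> 0
        - beta_coeff \<tau> \<nu> 2 + (1 / \<tau>) * beta_coeff \<tau> \<nu> 0 = 0"
      using second_order[OF \<nu>'] by (simp_all only: second_order_accurate_def consistent_def)
    have "\<tau> \<noteq> 0"
      using \<open>\<tau> > 0\<close> by simp
    from LTE_expansion[OF y this, of "alpha_coeff \<tau> \<nu>" "beta_coeff \<tau> \<nu>"] show ?thesis
      unfolding vanish LTE_third_coefficient[OF \<open>\<tau> > 0\<close> \<nu>']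
      by (simp only: mult_zero_right scaleR_zero_left add_0_left mult.commute[of "_ ^ 3"])
  qed
qed

end
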